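(* Every connected balanced $S_{1,3}$-free bipartite graph with minimum degree at least $4$ contains a Hamilton cycle.
   Context: All graphs are finite and simple (no loops or multiple edges). $S_{1,3}$ is the graph obtained from disjoint $K_{1,1}$ and $K_{1,3}$ by adding an edge between one vertex of $K_{1,1}$ and the vertex of degree $3$ in $K_{1,3}$. A graph is $F$-free if it contains no induced subgraph isomorphic to $F$. A bipartite graph $G=(X,Y;E)$ with bipartition $(X,Y)$ is balanced if $|X|=|Y|$. A Hamilton cycle is a cycle containing all vertices of the graph. *)

theory Defs
  imports Graph_Theory.Graph_Theory
begin

(* A finite simple graph is a pair_graph: a finite, symmetric, loop-free relation, each
   undirected edge being represented by its two opposite arcs. *)

(* 0 - 1 is the K(1,1), 2 is the centre of the K(1,3) with leaves 3, 4, 5, and 1 - 2 is the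
   added edge. *)
definition S13 :: "nat pair_pre_digraph" where
  "S13 = (let E = {0} \<times> {1} \<union> {2} \<times> {3, 4, 5} \<union> {(1, 2)}
          in \<lparr> pverts = {0, 1} \<union> {2, 3, 4, 5}, parcs = E \<union> E\<inverse> \<rparr>)"

definition induced_free :: "('c, 'd) pre_digraph \<Rightarrow> ('a, 'b) pre_digraph \<Rightarrow> bool" where
  "induced_free F G \<longleftrightarrow> \<not> (\<exists>H. induced_subgraph H G \<and> digraph_iso H F)"

definition bipartition :: "('a, 'b) pre_digraph \<Rightarrow> 'a set \<Rightarrow> 'a set \<Rightarrow> bool" where
  "bipartition G X Y \<longleftrightarrow>
     X \<union> Y = verts G \<and> X \<inter> Y = {} \<and> arcs_ends G \<subseteq> X \<times> Y \<union> Y \<times> X"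

definition balanced_bipartition :: "('a, 'b) pre_digraph \<Rightarrow> 'a set \<Rightarrow> 'a set \<Rightarrow> bool" where
  "balanced_bipartition G X Y \<longleftrightarrow> bipartition G X Y \<and> card X = card Y"

(* In a symmetric digraph without parallel arcs, the out-degree counts the neighbours.
   The value is meaningful only if the graph is finite and nonempty. *)
definition min_degree :: "('a, 'b) pre_digraph \<Rightarrow> nat" where
  "min_degree G = Min (out_degree G ` verts G)"

(* The length bound excludes the closed walk u, v, u along a single undirected edge, which
   pre_digraph.cycle accepts. The tails of the arcs of a cycle are exactly its vertices. *)
definition hamilton_cycle :: "('a, 'b) pre_digraph \<Rightarrow> 'b awalk \<Rightarrow> bool" where
  "hamilton_cycle G p \<longleftrightarrow>
     pre_digraph.cycle G p \<and> 3 \<le> length p \<and> tail G ` set p = verts G"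

end

theory Submission
  imports Defs
begin

text \<open>
  In a bipartite graph, $S_{1,3}$-freeness means that $|N(u) \setminus N(v)| \le 2$ whenever
  $N(u) \cap N(v) \neq \emptyset$. If $d(y) \ge 5$, then sharing a neighbour with \<open>y\<close> propagates
  along the connected graph, so \<open>y\<close> shares a neighbour with every vertex of its side. This makes
  Hall's condition hold both for the graph and for the graph minus a perfect matching, so there is
  a 2-factor.

  Choose a 2-factor \<open>F\<close> with as many connected pairs of vertices as possible and suppose that an
  edge \<open>xy\<close> joins two of its cycles. Since the cycles cannot be merged by exchanging edges, there
  are no edges between $F(x)$ and $F(y)$; as $x$ is a common neighbour of \<open>y\<close> and
  $a \in F(x)$, it follows that $N(y) \setminus F(y) \subseteq N(a)$. This forces every cycle of
  \<open>F\<close> to be a 4-cycle whose opposite vertices have the same neighbourhood. Selecting one vertex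
  of each such twin pair yields a 2-factor with only two cycles, each with at least six vertices,
  contradicting the choice of \<open>F\<close>.
\<close>

section \<open>Hall's theorem and degree counting\<close>

text \<open>Halmos-Vaughan induction on the size of \<open>X\<close>. If some nonempty proper subset
  \<open>S\<close> is tight, \<open>S\<close> is matched into its neighbours and
  \<open>X - S\<close> into what remains. If none is tight, an arbitrary edge can be fixed and
  removed.\<close>

lemma hall_marriage:
  fixes N :: "'a \<Rightarrow> 'b set"
  assumes "finite X" and "\<And>x. x \<in> X \<Longrightarrow> finite (N x)"
    and "\<And>S. S \<subseteq> X \<Longrightarrow> card S \<le> card (\<Union>(N ` S))"
  shows "\<exists>f. inj_on f X \<and> (\<forall>x\<in>X. f x \<in> N x)"
  using assms
proof (induction "card X" arbitrary: X N rule: less_induct)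
  case less
  have finU: "finite (\<Union>(N ` S))" if "S \<subseteq> X" for S
    using that less.prems by (auto intro: finite_subset)
  show ?case
  proof (cases "X = {}")
    case True
    then show ?thesis by auto
  next
    case False
    show ?thesis
    proof (cases "\<exists>S. S \<subset> X \<and> S \<noteq> {} \<and> card (\<Union>(N ` S)) = card S")
      case True
      then obtain S where S: "S \<subset> X" "S \<noteq> {}" "card (\<Union>(N ` S)) = card S" by blast
      have finS: "finite S" using S less.prems(1) finite_subset by blast
      have "card S < card X" using S less.prems(1) psubset_card_mono by blast
      then obtain f where f: "inj_on f S" "\<And>x. x \<in> S \<Longrightarrow> f x \<in> N x"
        using less.hyps[of S N] S less.prems finS by (metis psubsetE subset_iff subset_trans)
      define M where "M x = N x - \<Union>(N ` S)" for x
      have "card (X - S) < card X"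
        using S less.prems(1) by (metis Diff_subset psubsetI Diff_disjoint Diff_eq_empty_iff
            double_diff order_refl psubset_card_mono psubset_imp_subset)
      \<comment> \<open>Hall's condition for \<open>S \<union> T\<close> loses exactly
        \<open>card S\<close> when the neighbours of \<open>S\<close> are discarded, because
        \<open>S\<close> is tight.\<close>
      moreover have "card T \<le> card (\<Union>(M ` T))" if T: "T \<subseteq> X - S" for T
      proof -
        have finT: "finite T" using T less.prems(1) by (meson finite_Diff finite_subset)
        have "card S + card T = card (S \<union> T)"
          using T finS finT by (subst card_Un_disjoint) auto
        also have "\<dots> \<le> card (\<Union>(N ` (S \<union> T)))" using T S less.prems(3)[of "S \<union> T"] by blast
        also have "\<Union>(N ` (S \<union> T)) = \<Union>(N ` S) \<union> \<Union>(M ` T)" by (auto simp: M_def)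
        also have "card \<dots> \<le> card (\<Union>(N ` S)) + card (\<Union>(M ` T))" by (rule card_Un_le)
        finally show ?thesis using S(3) by simp
      qed
      moreover have "finite (M x)" if "x \<in> X - S" for x
        using that less.prems(2) by (simp add: M_def)
      ultimately obtain g where g: "inj_on g (X - S)" "\<And>x. x \<in> X - S \<Longrightarrow> g x \<in> M x"
        using less.hyps[of "X - S" M] less.prems(1) by (metis finite_Diff)
      define h where "h x = (if x \<in> S then f x else g x)" for x
      have "inj_on h X"
      proof (rule inj_onI)
        fix x y assume xy: "x \<in> X" "y \<in> X" "h x = h y"
        have 1: "f a \<noteq> g b" if "a \<in> S" "b \<in> X - S" for a b
          using f(2)[OF that(1)] g(2)[OF that(2)] that by (auto simp: M_def)
        from xy show "x = y"
          using f(1) g(1) 1 1[symmetric] by (auto simp: h_def inj_on_def split: if_splits)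
      qed
      moreover have "\<forall>x\<in>X. h x \<in> N x" using f(2) g(2) by (auto simp: h_def M_def)
      ultimately show ?thesis by blast
    next
      case crit: False
      obtain x where x: "x \<in> X" using \<open>X \<noteq> {}\<close> by blast
      have "card {x} \<le> card (\<Union>(N ` {x}))" using x less.prems(3)[of "{x}"] by blast
      then obtain y where y: "y \<in> N x" by (cases "N x = {}") auto
      have "card (X - {x}) < card X" using x less.prems(1) by (meson card_Diff1_less)
      \<comment> \<open>A nonempty \<open>T\<close> omits \<open>x\<close>, so it is not tight and
        has a surplus of one, which pays for the removal of \<open>y\<close>.\<close>
      moreover have "card T \<le> card (\<Union>((\<lambda>z. N z - {y}) ` T))" if T: "T \<subseteq> X - {x}" for T
      proof (cases "T = {}")
        case False
        have "card T \<le> card (\<Union>(N ` T))" "card (\<Union>(N ` T)) \<noteq> card T"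
          using T x False less.prems(3)[of T] crit by auto
        then have "card T \<le> card (\<Union>(N ` T)) - 1" by simp
        also have "\<dots> \<le> card (\<Union>(N ` T) - {y})" by (simp add: card_Diff_singleton_if)
        also have "\<Union>(N ` T) - {y} = \<Union>((\<lambda>z. N z - {y}) ` T)" by auto
        finally show ?thesis .
      qed auto
      ultimately obtain g where g: "inj_on g (X - {x})" "\<And>z. z \<in> X - {x} \<Longrightarrow> g z \<in> N z - {y}"
        using less.hyps[of "X - {x}" "\<lambda>z. N z - {y}"] less.prems(1,2)
        by (metis Diff_iff finite_Diff)
      have "inj_on (g(x := y)) X"
        using g by (auto simp: inj_on_def)
      moreover have "\<forall>z\<in>X. (g(x := y)) z \<in> N z" using g(2) y by auto
      ultimately show ?thesis by blast
    qed
  qed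
qed

lemma card_Int_Times_eq_sum:
  assumes "finite P" and "\<And>v. v \<in> P \<Longrightarrow> finite (R `` {v})" and "R `` P \<subseteq> Q"
  shows "card (R \<inter> P \<times> Q) = (\<Sum>v\<in>P. card (R `` {v}))"
proof -
  have "R \<inter> P \<times> Q = (SIGMA v:P. R `` {v})" using assms(3) by auto
  then show ?thesis using assms by simp
qed

lemma card_converse_Int: "card (R\<inverse> \<inter> Q \<times> P) = card (R \<inter> P \<times> Q)"
proof -
  have "R\<inverse> \<inter> Q \<times> P = (R \<inter> P \<times> Q)\<inverse>" by auto
  then show ?thesis by simp
qed

text \<open>Both sums count the edges between \<open>P\<close> and \<open>Q\<close>.\<close>

lemma bipartite_degree_sum:
  assumes "finite P" "finite Q" and "sym R" and "R `` P \<subseteq> Q" "R `` Q \<subseteq> P"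
  shows "(\<Sum>v\<in>P. card (R `` {v})) = (\<Sum>v\<in>Q. card (R `` {v}))"
proof -
  have "finite (R `` {v})" if "v \<in> P" for v
    using assms that by (meson Image_mono finite_subset subset_refl empty_subsetI insert_subset)
  then have "(\<Sum>v\<in>P. card (R `` {v})) = card (R \<inter> P \<times> Q)"
    using assms by (subst card_Int_Times_eq_sum) auto
  also have "\<dots> = card (R \<inter> Q \<times> P)"
    using card_converse_Int[of R Q P] assms(3) by (simp add: sym_conv_converse_eq)
  also have "finite (R `` {v})" if "v \<in> Q" for v
    using assms that by (meson Image_mono finite_subset subset_refl empty_subsetI insert_subset)
  then have "card (R \<inter> Q \<times> P) = (\<Sum>v\<in>Q. card (R `` {v}))"
    using assms by (subst card_Int_Times_eq_sum) auto
  finally show ?thesis .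
qed

section \<open>Two-factors of bipartite graphs\<close>

locale bipartite_graph =
  fixes E :: "('a \<times> 'a) set" and X Y :: "'a set"
  assumes finite_X: "finite X" and finite_Y: "finite Y" and disjoint: "X \<inter> Y = {}"
    and edges: "E \<subseteq> X \<times> Y \<union> Y \<times> X" and sym_E: "sym E"
begin

lemma edge_sym: "(u, v) \<in> E \<Longrightarrow> (v, u) \<in> E"
  using sym_E by (rule symD)

lemma finite_E: "finite E"
  using edges finite_X finite_Y by (auto intro: finite_subset)

lemma finite_nbrs: "finite (E `` A)"
  using finite_E by (rule finite_Image)

lemma nbrs_X: "x \<in> X \<Longrightarrow> E `` {x} \<subseteq> Y" and nbrs_Y: "y \<in> Y \<Longrightarrow> E `` {y} \<subseteq> X"
  using edges disjoint by auto

lemma edge_verts: "(u, v) \<in> E \<Longrightarrow> u \<in> X \<union> Y" "(u, v) \<in> E \<Longrightarrow> v \<in> X \<union> Y"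
  using edges by auto

lemma edge_sides: "(u, v) \<in> E \<Longrightarrow> u \<in> X \<longleftrightarrow> v \<notin> X"
  using edges disjoint by auto

text \<open>A 2-factor is kept as a symmetric relation. Its cycles are then the classes of
  \<open>F\<^sup>*\<close> on the vertices, so they never have to be listed explicitly.\<close>

definition two_factor :: "('a \<times> 'a) set \<Rightarrow> bool" where
  "two_factor F \<longleftrightarrow> F \<subseteq> E \<and> sym F \<and> (\<forall>v\<in>X \<union> Y. card (F `` {v}) = 2)"

text \<open>Otherwise \<open>x\<close> would be the only vertex of odd degree in its component, impossible by
  counting the edges of the component from both sides.\<close>
lemma two_factor_no_bridge:
  assumes F: "two_factor F" and xa: "(x, a) \<in> F"
    and F0: "F0 \<subseteq> F" "sym F0" "F0 `` {x} = F `` {x} - {a}"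
    and same: "\<And>v. (x, v) \<in> F0\<^sup>* \<Longrightarrow> v \<noteq> x \<Longrightarrow> v \<noteq> a \<Longrightarrow> F0 `` {v} = F `` {v}"
  shows "(x, a) \<in> F0\<^sup>*"
proof (rule ccontr)
  assume na: "(x, a) \<notin> F0\<^sup>*"
  define A where "A = {v. (x, v) \<in> F0\<^sup>*}"
  have xX: "x \<in> X \<union> Y" and card2: "\<And>v. v \<in> X \<union> Y \<Longrightarrow> card (F `` {v}) = 2" and FE: "F \<subseteq> E"
    using F xa edge_verts(1) unfolding two_factor_def by blast+
  have aA: "a \<notin> A" and xA: "x \<in> A" using na by (auto simp: A_def)
  have AA: "F0 `` A \<subseteq> A" by (auto simp: A_def intro: rtrancl_into_rtrancl)
  have deg: "card (F0 `` {v}) = (if v = x then 1 else 2)" if "v \<in> A" "v \<in> X \<union> Y" for v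
  proof (cases "v = x")
    case True
    have "a \<in> F `` {x}" using xa by simp
    then have "card (F `` {x} - {a}) = 1" using card2[OF xX] by simp
    then show ?thesis using True F0(3) by simp
  next
    case False
    moreover have "v \<noteq> a" using that aA by blast
    ultimately show ?thesis using same[of v] that card2[of v] by (simp add: A_def)
  qed
  \<comment> \<open>Inside \<open>A\<close> only \<open>x\<close> has odd degree in
    \<open>F0\<close>, so the degree sum is odd on exactly one of the two sides, the one containing
    \<open>x\<close>.\<close>
  have parity: "even (\<Sum>v\<in>A \<inter> S. card (F0 `` {v})) \<longleftrightarrow> x \<notin> S" if "S \<subseteq> X \<union> Y" for S
  proof -
    have fin: "finite (A \<inter> S)" using that finite_X finite_Y by (auto intro: finite_subset)
    have "(\<Sum>v\<in>A \<inter> S. card (F0 `` {v})) = (\<Sum>v\<in>A \<inter> S. if v = x then 1 else 2)"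
      using deg that by (intro sum.cong) auto
    then have "even (\<Sum>v\<in>A \<inter> S. card (F0 `` {v})) \<longleftrightarrow>
        even (card {v \<in> A \<inter> S. odd (if v = x then 1 else 2 :: nat)})"
      using fin by (simp only: even_sum_iff)
    also have "{v \<in> A \<inter> S. odd (if v = x then 1 else 2 :: nat)} = A \<inter> S \<inter> {x}" by auto
    finally show ?thesis using xA by (cases "x \<in> S") auto
  qed
  have "F0 `` (A \<inter> X) \<subseteq> A \<inter> Y" "F0 `` (A \<inter> Y) \<subseteq> A \<inter> X"
    using AA F0(1) FE edges disjoint by blast+
  then have "(\<Sum>v\<in>A \<inter> X. card (F0 `` {v})) = (\<Sum>v\<in>A \<inter> Y. card (F0 `` {v}))"
    using finite_X finite_Y F0(2) by (intro bipartite_degree_sum) auto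
  then show False using parity[of X] parity[of Y] xX disjoint by auto
qed

text \<open>Exchanging the edges \<open>xa\<close> and \<open>yb\<close> for \<open>xy\<close> and
  \<open>ab\<close> preserves all degrees and fuses the cycles through \<open>x\<close> and
  \<open>y\<close> into one.\<close>

lemma two_factor_merge:
  assumes F: "two_factor F" and xy: "(x, y) \<in> E" "(x, y) \<notin> F\<^sup>*"
    and xa: "(x, a) \<in> F" and yb: "(y, b) \<in> F" and ab: "(a, b) \<in> E"
  shows "\<exists>F'. two_factor F' \<and> F\<^sup>* \<subset> F'\<^sup>*"
proof -
  have FE: "F \<subseteq> E" and symF: "sym F"
    and card2: "\<And>v. v \<in> X \<union> Y \<Longrightarrow> card (F `` {v}) = 2"
    using F by (auto simp: two_factor_def)
  have symFs: "sym (F\<^sup>*)" using symF by (rule sym_rtrancl)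
  note sF = symD[OF symF] and sFs = symD[OF symFs]
  have verts: "x \<in> X \<union> Y" "y \<in> X \<union> Y" "a \<in> X \<union> Y" "b \<in> X \<union> Y"
    using xy ab edge_verts by blast+
  have conn: "(x, a) \<in> F\<^sup>*" "(y, b) \<in> F\<^sup>*" using xa yb by auto
  have sep: "(x, b) \<notin> F\<^sup>*" "(y, a) \<notin> F\<^sup>*" "(y, x) \<notin> F\<^sup>*"
    using conn xy(2) sFs by (meson rtrancl_trans)+
  have neq: "x \<noteq> y" "a \<noteq> b" "x \<noteq> a" "y \<noteq> b" "x \<noteq> b" "y \<noteq> a"
    using xy ab FE xa yb edge_sides sep by auto
  define D where "D = {(x, a), (a, x), (y, b), (b, y)}"
  define F0 where "F0 = F - D"
  define F' where "F' = F0 \<union> {(x, y), (y, x), (a, b), (b, a)}"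
  have sym0: "sym F0" using symF by (auto simp: F0_def D_def sym_def)
  have sym': "sym F'" using sym0 by (auto simp: F'_def sym_def)
  have F0F: "F0 \<subseteq> F" by (auto simp: F0_def)
  have reach0: "(u, v) \<in> F\<^sup>*" if "(u, v) \<in> F0\<^sup>*" for u v
    using that F0F rtrancl_mono by blast
  \<comment> \<open>Without \<open>xa\<close> the cycle through \<open>x\<close> is still a path
    from \<open>x\<close> to \<open>a\<close>; the other removed edge \<open>yb\<close> lies in a
    different component.\<close>
  have xa0: "(x, a) \<in> F0\<^sup>*"
  proof (rule two_factor_no_bridge[OF F xa F0F sym0])
    show "F0 `` {x} = F `` {x} - {a}" using neq by (auto simp: F0_def D_def)
    fix v assume v: "(x, v) \<in> F0\<^sup>*" "v \<noteq> x" "v \<noteq> a"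
    then have "v \<noteq> y" "v \<noteq> b" using reach0 xy(2) sep by auto
    then show "F0 `` {v} = F `` {v}" using v by (auto simp: F0_def D_def)
  qed
  have yb0: "(y, b) \<in> F0\<^sup>*"
  proof (rule two_factor_no_bridge[OF F yb F0F sym0])
    show "F0 `` {y} = F `` {y} - {b}" using neq by (auto simp: F0_def D_def)
    fix v assume v: "(y, v) \<in> F0\<^sup>*" "v \<noteq> y" "v \<noteq> b"
    then have "v \<noteq> x" "v \<noteq> a" using reach0 sep by auto
    then show "F0 `` {v} = F `` {v}" using v by (auto simp: F0_def D_def)
  qed
  have "F0\<^sup>* \<subseteq> F'\<^sup>*" by (rule rtrancl_mono) (auto simp: F'_def)
  then have r': "(x, a) \<in> F'\<^sup>*" "(y, b) \<in> F'\<^sup>*" using xa0 yb0 by auto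
  then have r'': "(a, x) \<in> F'\<^sup>*" "(b, y) \<in> F'\<^sup>*"
    using symD[OF sym_rtrancl[OF sym']] by auto
  \<comment> \<open>Each removed edge is bypassed by the path that remains between its ends.\<close>
  have "F \<subseteq> F'\<^sup>*"
  proof clarify
    fix u v assume uv: "(u, v) \<in> F"
    show "(u, v) \<in> F'\<^sup>*"
    proof (cases "(u, v) \<in> D")
      case True
      then show ?thesis using r' r'' by (auto simp: D_def)
    next
      case False
      then show ?thesis using uv by (auto simp: F'_def F0_def)
    qed
  qed
  then have "F\<^sup>* \<subseteq> F'\<^sup>*" using rtrancl_subset_rtrancl by blast
  moreover have "(x, y) \<in> F'\<^sup>*" by (auto simp: F'_def)
  ultimately have "F\<^sup>* \<subset> F'\<^sup>*" using xy(2) by blast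
  moreover have "two_factor F'"
    unfolding two_factor_def
  proof (intro conjI ballI)
    show "F' \<subseteq> E" using FE xy ab edge_sym by (auto simp: F'_def F0_def)
    show "sym F'" by (rule sym')
    fix v assume v: "v \<in> X \<union> Y"
    have swap: "card (insert p (F `` {v} - {q})) = 2" if "p \<notin> F `` {v}" "q \<in> F `` {v}" for p q
    proof -
      have "finite (F `` {v})" using card2[OF v] by (metis card.infinite zero_neq_numeral)
      then show ?thesis using that card2[OF v] by simp
    qed
    \<comment> \<open>Both new edges join different components of \<open>F\<close>, so each of the
      four ends really gains a neighbour in place of the lost one.\<close>
    have nF: "(x, y) \<notin> F" "(y, x) \<notin> F" "(a, b) \<notin> F" "(b, a) \<notin> F"
      using xy(2) sF sep conn by (auto intro: rtrancl_into_rtrancl)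
    consider "v = x" | "v = y" | "v = a" | "v = b" | "v \<notin> {x, y, a, b}" by blast
    then show "card (F' `` {v}) = 2"
    proof cases
      case 1
      have "F' `` {v} = insert y (F `` {v} - {a})"
        using 1 neq by (auto simp: F'_def F0_def D_def)
      then show ?thesis using swap[of y a] 1 nF xa by auto
    next
      case 2
      have "F' `` {v} = insert x (F `` {v} - {b})"
        using 2 neq by (auto simp: F'_def F0_def D_def)
      then show ?thesis using swap[of x b] 2 nF yb by auto
    next
      case 3
      have "F' `` {v} = insert b (F `` {v} - {x})"
        using 3 neq by (auto simp: F'_def F0_def D_def)
      then show ?thesis using swap[of b x] 3 nF sF[OF xa] by auto
    next
      case 4
      have "F' `` {v} = insert a (F `` {v} - {y})"
        using 4 neq by (auto simp: F'_def F0_def D_def)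
      then show ?thesis using swap[of a y] 4 nF sF[OF yb] by auto
    next
      case 5
      then have "F' `` {v} = F `` {v}" by (auto simp: F'_def F0_def D_def)
      then show ?thesis using card2[OF v] by simp
    qed
  qed
  ultimately show ?thesis by blast
qed

end

section \<open>Existence of a two-factor\<close>

locale balanced_S13_free_graph = bipartite_graph +
  assumes balanced: "card X = card Y"
    and conn: "\<And>u v. u \<in> X \<union> Y \<Longrightarrow> v \<in> X \<union> Y \<Longrightarrow> (u, v) \<in> E\<^sup>*"
    and min_deg: "\<And>v. v \<in> X \<union> Y \<Longrightarrow> 4 \<le> card (E `` {v})"
    and S13_free: "\<And>u v. E `` {u} \<inter> E `` {v} \<noteq> {} \<Longrightarrow> card (E `` {u} - E `` {v}) \<le> 2"
begin

lemma card_Int_nbrs: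
  assumes "E `` {u} \<inter> E `` {v} \<noteq> {}"
  shows "card (E `` {u}) \<le> card (E `` {u} \<inter> E `` {v}) + 2"
proof -
  have "card (E `` {u}) = card (E `` {u} \<inter> E `` {v}) + card (E `` {u} - E `` {v})"
    using finite_nbrs by (metis card_Int_Diff)
  then show ?thesis using S13_free[OF assms] by simp
qed

text \<open>At least \<open>5 - 2 = 3\<close> neighbours of \<open>u\<close> are neighbours of
  \<open>v\<close>. If \<open>u\<close> and \<open>w\<close> had no common neighbour, all three
  would lie in \<open>E\<close> {v} - E \<open>{w}\<close>, against \<open>S13_free\<close>.\<close>

lemma common_nbr_trans:
  assumes deg: "5 \<le> card (E `` {u})"
    and uv: "E `` {u} \<inter> E `` {v} \<noteq> {}" and vw: "E `` {v} \<inter> E `` {w} \<noteq> {}"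
  shows "E `` {u} \<inter> E `` {w} \<noteq> {}"
proof
  assume disj: "E `` {u} \<inter> E `` {w} = {}"
  obtain p where "(w, p) \<in> E" using vw by auto
  then have "4 \<le> card (E `` {w})" using min_deg edge_verts by blast
  moreover have "card (E `` {w}) \<le> card (E `` {w} \<inter> E `` {v}) + 2"
    using vw by (intro card_Int_nbrs) auto
  ultimately have "2 \<le> card (E `` {v} \<inter> E `` {w})" by (simp add: Int_commute)
  moreover have "3 \<le> card (E `` {v} \<inter> E `` {u})"
    using card_Int_nbrs[OF uv] deg by (simp add: Int_commute)
  moreover have "card (E `` {v}) \<le> card (E `` {v} \<inter> E `` {u}) + 2"
    using uv by (intro card_Int_nbrs) auto
  moreover have "card (E `` {v}) \<le> card (E `` {v} \<inter> E `` {w}) + 2"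
    using vw by (intro card_Int_nbrs) auto
  moreover have "card (E `` {v} \<inter> E `` {u}) + card (E `` {v} \<inter> E `` {w}) \<le> card (E `` {v})"
  proof -
    have "card (E `` {v} \<inter> E `` {u}) + card (E `` {v} \<inter> E `` {w}) =
        card (E `` {v} \<inter> E `` {u} \<union> E `` {v} \<inter> E `` {w})"
      using disj finite_nbrs by (intro card_Un_disjoint[symmetric]) auto
    also have "\<dots> \<le> card (E `` {v})"
      using finite_nbrs by (intro card_mono) auto
    finally show ?thesis .
  qed
  ultimately show False by simp
qed

text \<open>Sharing a neighbour with \<open>y\<close> is carried along a walk from \<open>y\<close>
  to \<open>z\<close> by \<open>common_nbr_trans\<close>, since vertices two steps apart on the walk
  share the one between them.\<close>

lemma common_nbr_if_large_degree:
  assumes y: "y \<in> Y" "5 \<le> card (E `` {y})" and z: "z \<in> Y"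
  shows "E `` {y} \<inter> E `` {z} \<noteq> {}"
proof -
  \<comment> \<open>The conjunct for \<open>X\<close> remembers a suitable vertex of
    \<open>Y\<close> across the intermediate steps of the walk.\<close>
  have "(v \<in> Y \<longrightarrow> E `` {y} \<inter> E `` {v} \<noteq> {}) \<and>
      (v \<in> X \<longrightarrow> (\<exists>w. (v, w) \<in> E \<and> E `` {y} \<inter> E `` {w} \<noteq> {}))" if "(y, v) \<in> E\<^sup>*" for v
    using that
  proof (induction rule: rtrancl_induct)
    case base
    have "E `` {y} \<noteq> {}" using y(2) by force
    then show ?case using y(1) disjoint by blast
  next
    case (step v w)
    have "v \<in> X \<longleftrightarrow> w \<notin> X" "v \<in> X \<union> Y" "w \<in> X \<union> Y"
      using step(2) edge_sides edge_verts by blast+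
    then consider "v \<in> Y" "w \<in> X" | "v \<in> X" "w \<in> Y" using disjoint by blast
    then show ?case
    proof cases
      case 1
      then show ?thesis using step disjoint edge_sym by blast
    next
      case 2
      then obtain u where u: "(v, u) \<in> E" "E `` {y} \<inter> E `` {u} \<noteq> {}" using step by blast
      have "E `` {u} \<inter> E `` {w} \<noteq> {}" using u(1) step(2) edge_sym by blast
      then show ?thesis using common_nbr_trans[OF y(2) u(2)] 2 disjoint by blast
    qed
  qed
  then show ?thesis using conn[of y z] y(1) z by blast
qed

text \<open>With \<open>k = 0\<close> this yields a perfect matching and with \<open>k = 1\<close> a second, edge-disjoint one.\<close>
lemma perfect_matching_avoiding:
  assumes M: "M \<subseteq> E" and k: "k \<le> 1"
    and Mx: "\<And>x. x \<in> X \<Longrightarrow> card (M `` {x}) = k"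
    and My: "\<And>y. y \<in> Y \<Longrightarrow> card (M\<inverse> `` {y}) = k"
  shows "\<exists>f. inj_on f X \<and> (\<forall>x\<in>X. f x \<in> E `` {x} - M `` {x})"
proof (rule hall_marriage[OF finite_X])
  show "finite (E `` {x} - M `` {x})" for x using finite_nbrs by blast
next
  fix S assume S: "S \<subseteq> X"
  define T where "T = (\<Union>x\<in>S. E `` {x} - M `` {x})"
  have finS: "finite S" using S finite_X finite_subset by blast
  have TY: "T \<subseteq> Y" using S nbrs_X by (auto simp: T_def)
  have finT: "finite T" using TY finite_Y finite_subset by blast
  have finM: "finite M" using M finite_E finite_subset by blast
  define H where "H = E - M"
  have finH: "finite H" using finite_E by (simp add: H_def)
  show "card S \<le> card T"
  proof (rule ccontr)
    assume less: "\<not> card S \<le> card T"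
    then have "card T < card Y"
      using card_mono[OF finite_X S] balanced by simp
    \<comment> \<open>A set \<open>S\<close> violating Hall's condition has
      \<open>card T < card S \<le> card X = card Y\<close>, so \<open>T\<close> misses a vertex of
      \<open>Y\<close>. Its edges into \<open>S\<close> must all lie in \<open>M\<close>.\<close>
    then obtain z where z: "z \<in> Y" "z \<notin> T"
      using TY by (metis nat_neq_iff subsetI subset_antisym)
    have "E `` {z} \<inter> S \<subseteq> M\<inverse> `` {z}"
      using z(2) edge_sym by (auto simp: T_def)
    then have zS: "card (E `` {z} \<inter> S) \<le> k"
      using My[OF z(1)] finM by (metis card_mono finite_Image finite_converse)
    \<comment> \<open>A vertex of larger degree would share a neighbour with \<open>z\<close>, which sees at most \<open>k\<close>
      vertices of \<open>S\<close>, contradicting \<open>S13_free\<close>.\<close>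
    have few: "card (H\<inverse> `` {y} \<inter> S) \<le> 4 - k" if y: "y \<in> T" for y
    proof (rule ccontr)
      assume many: "\<not> card (H\<inverse> `` {y} \<inter> S) \<le> 4 - k"
      have yY: "y \<in> Y" using y TY by blast
      have "H\<inverse> `` {y} = E `` {y} - M\<inverse> `` {y}" using edge_sym by (auto simp: H_def)
      moreover have "M\<inverse> `` {y} \<subseteq> E `` {y}" using M edge_sym by auto
      ultimately have "card (H\<inverse> `` {y}) + k = card (E `` {y})"
        using My[OF yY] finite_nbrs
        by (metis card_Diff_subset card_mono finite_subset le_add_diff_inverse2)
      moreover have "card (H\<inverse> `` {y} \<inter> S) \<le> card (H\<inverse> `` {y})"
        using finH by (intro card_mono) auto
      ultimately have "5 \<le> card (E `` {y})" using many k by simp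
      then have "E `` {y} \<inter> E `` {z} \<noteq> {}" using common_nbr_if_large_degree yY z by blast
      then have "card (E `` {y} - E `` {z}) \<le> 2" by (rule S13_free)
      moreover have "H\<inverse> `` {y} \<inter> S - E `` {z} \<inter> S \<subseteq> E `` {y} - E `` {z}"
        using edge_sym by (auto simp: H_def)
      then have "card (H\<inverse> `` {y} \<inter> S - E `` {z} \<inter> S) \<le> card (E `` {y} - E `` {z})"
        using finite_nbrs by (intro card_mono) auto
      moreover have "card (H\<inverse> `` {y} \<inter> S) - card (E `` {z} \<inter> S) \<le>
          card (H\<inverse> `` {y} \<inter> S - E `` {z} \<inter> S)"
        using finS by (intro diff_card_le_card_Diff) auto
      \<comment> \<open>More than \<open>4 - k\<close> vertices, less at most \<open>k\<close>
        neighbours of \<open>z\<close>, leave at least \<open>5 - 2 * k \<ge> 3\<close> because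
        \<open>k \<le> 1\<close>.\<close>
      ultimately show False using many zS k by simp
    qed
    have "4 - k \<le> card (H `` {x})" if "x \<in> S" for x
    proof -
      have "H `` {x} = E `` {x} - M `` {x}" by (auto simp: H_def)
      moreover have "card (E `` {x}) - card (M `` {x}) \<le> card (E `` {x} - M `` {x})"
        using finM by (intro diff_card_le_card_Diff) auto
      moreover have "4 \<le> card (E `` {x})" "card (M `` {x}) = k"
        using that S min_deg Mx by blast+
      ultimately show ?thesis by simp
    qed
    \<comment> \<open>Double counting of the edges of \<open>H\<close> between \<open>S\<close> and
      \<open>T\<close>: each vertex of \<open>S\<close> has at least \<open>4 - k\<close> of them
      and each vertex of \<open>T\<close> at most \<open>4 - k\<close>.\<close>
    then have "card S * (4 - k) \<le> (\<Sum>x\<in>S. card (H `` {x}))"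
      using sum_bounded_below[of S "4 - k"] by simp
    also have "\<dots> = card (H \<inter> S \<times> T)"
      using finS finH by (intro card_Int_Times_eq_sum[symmetric]) (auto simp: H_def T_def)
    \<comment> \<open>Vertices of \<open>T\<close> may have \<open>H\<close>-neighbours outside
      \<open>S\<close>; intersecting with \<open>UNIV \<times> S\<close> drops them before counting
      from the side of \<open>T\<close>.\<close>
    also have "\<dots> = card ((H\<inverse> \<inter> UNIV \<times> S) \<inter> T \<times> S)"
      using card_converse_Int[of H T S] by (simp add: Int_absorb1 Int_assoc Times_Int_Times)
    also have "\<dots> = (\<Sum>y\<in>T. card ((H\<inverse> \<inter> UNIV \<times> S) `` {y}))"
      using finT finH by (intro card_Int_Times_eq_sum) auto
    also have "\<dots> = (\<Sum>y\<in>T. card (H\<inverse> `` {y} \<inter> S))"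
      by (intro sum.cong arg_cong[of _ _ card]) auto
    also have "\<dots> \<le> card T * (4 - k)"
      using sum_bounded_above[of T _ "4 - k"] few by simp
    finally show False using less k by simp
  qed
qed

text \<open>The union of a perfect matching \<open>f\<close> and a second one \<open>g\<close> that
  avoids its edges has degree 2 everywhere.\<close>

lemma ex_two_factor: "\<exists>F. two_factor F"
proof -
  have inj_card: "f ` X = Y" if "inj_on f X" "\<forall>x\<in>X. f x \<in> E `` {x}" for f
  proof -
    have "f ` X \<subseteq> Y" using that(2) nbrs_X by blast
    then show ?thesis
      using card_image[OF that(1)] balanced finite_Y by (simp add: card_subset_eq)
  qed
  obtain f where f: "inj_on f X" "\<forall>x\<in>X. f x \<in> E `` {x}"
    using perfect_matching_avoiding[of "{}" 0] by auto
  have fY: "f ` X = Y" using inj_card f by blast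
  define M where "M = (\<lambda>x. (x, f x)) ` X"
  have MX: "M `` {x} = {f x}" if "x \<in> X" for x using that by (auto simp: M_def)
  have graph_inv: "card (((\<lambda>x. (x, h x)) ` X)\<inverse> `` {y}) = 1" if "inj_on h X" "h ` X = Y" "y \<in> Y"
    for h :: "'a \<Rightarrow> 'a" and y
  proof -
    from that(2,3) obtain x where "x \<in> X" "y = h x" by blast
    then have "((\<lambda>x. (x, h x)) ` X)\<inverse> `` {y} = {x}" using that(1) by (auto simp: inj_on_def)
    then show ?thesis by simp
  qed
  have "\<exists>g. inj_on g X \<and> (\<forall>x\<in>X. g x \<in> E `` {x} - M `` {x})"
    using f(2) graph_inv[OF f(1) fY] MX
    by (intro perfect_matching_avoiding[of M 1]) (auto simp: M_def)
  then obtain g where g: "inj_on g X" "\<And>x. x \<in> X \<Longrightarrow> g x \<in> E `` {x}" "\<And>x. x \<in> X \<Longrightarrow> g x \<noteq> f x"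
    using MX by blast
  have gY: "g ` X = Y" using inj_card g by blast
  define F where "F = (\<Union>x\<in>X. {(x, f x), (x, g x), (f x, x), (g x, x)})"
  have "two_factor F"
    unfolding two_factor_def
  proof (intro conjI ballI)
    show "F \<subseteq> E" using f(2) g(2) edge_sym by (auto simp: F_def)
    show "sym F" by (auto simp: F_def sym_def)
    fix v assume "v \<in> X \<union> Y"
    then show "card (F `` {v}) = 2"
    proof
      assume v: "v \<in> X"
      then have "F `` {v} = {f v, g v}" using fY gY disjoint by (auto simp: F_def)
      then show ?thesis using g(3)[OF v] by simp
    next
      assume v: "v \<in> Y"
      obtain p where p: "p \<in> X" "f p = v" using v unfolding fY[symmetric] by (rule imageE) simp
      obtain q where q: "q \<in> X" "g q = v" using v unfolding gY[symmetric] by (rule imageE) simp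
      have "p \<noteq> q" using p q g(3)[of p] by auto
      moreover have "F `` {v} = {p, q}"
      proof -
        have "v \<notin> X" using v disjoint by blast
        then have "F `` {v} = {x \<in> X. f x = v} \<union> {x \<in> X. g x = v}"
          unfolding F_def by blast
        also have "{x \<in> X. f x = v} = {p}" using p inj_onD[OF f(1)] by blast
        also have "{x \<in> X. g x = v} = {q}" using q inj_onD[OF g(1)] by blast
        finally show ?thesis by blast
      qed
      ultimately show ?thesis by simp
    qed
  qed
  then show ?thesis by blast
qed

end

section \<open>Edges between different cycles of an optimal two-factor\<close>

context balanced_S13_free_graph
begin

text \<open>For a 2-factor this is the sum of the squares of its cycle lengths, the number of
  ordered pairs on a common cycle. It is the quantity to be maximised.\<close>

definition reach_count :: "('a \<times> 'a) set \<Rightarrow> nat" where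
  "reach_count F = (\<Sum>v\<in>X \<union> Y. card (F\<^sup>* `` {v}))"

lemma two_factor_reach_subset:
  assumes "two_factor F" "v \<in> X \<union> Y"
  shows "F\<^sup>* `` {v} \<subseteq> X \<union> Y"
proof -
  have "F `` (X \<union> Y) \<subseteq> X \<union> Y"
    using assms(1) edge_verts unfolding two_factor_def by blast
  then have "F\<^sup>* `` (X \<union> Y) = X \<union> Y" by (rule Image_closed_trancl)
  then show ?thesis using assms(2) by blast
qed

lemma reach_count_strict_mono:
  assumes F: "two_factor F" "two_factor F'" and sub: "F\<^sup>* \<subset> F'\<^sup>*"
  shows "reach_count F < reach_count F'"
proof -
  have fin: "finite (F'\<^sup>* `` {v})" if "v \<in> X \<union> Y" for v
    using two_factor_reach_subset[OF F(2) that] finite_X finite_Y by (auto intro: finite_subset)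
  obtain u w where uw: "(u, w) \<in> F'\<^sup>*" "(u, w) \<notin> F\<^sup>*" using sub by auto
  \<comment> \<open>\<open>F'\<^sup>*\<close> relates even non-vertices to themselves; only a pair
    of distinct elements guarantees that \<open>u\<close> has an edge and is a vertex.\<close>
  then have "u \<noteq> w" by blast
  then obtain t where "(u, t) \<in> F'" using uw(1) by (meson converse_rtranclE)
  then have u: "u \<in> X \<union> Y" using F(2) edge_verts unfolding two_factor_def by blast
  show ?thesis
    unfolding reach_count_def
  proof (rule sum_strict_mono_ex1)
    show "finite (X \<union> Y)" using finite_X finite_Y by simp
    show "\<forall>v\<in>X \<union> Y. card (F\<^sup>* `` {v}) \<le> card (F'\<^sup>* `` {v})"
      using sub fin by (auto intro!: card_mono)
    have "F\<^sup>* `` {u} \<subset> F'\<^sup>* `` {u}" using sub uw by blast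
    then show "\<exists>v\<in>X \<union> Y. card (F\<^sup>* `` {v}) < card (F'\<^sup>* `` {v})"
      using u fin psubset_card_mono by blast
  qed
qed

context
  fixes F
  assumes F: "two_factor F"
    and max: "\<And>F'. two_factor F' \<Longrightarrow> reach_count F' \<le> reach_count F"
begin

lemma F_sym: "(u, v) \<in> F \<Longrightarrow> (v, u) \<in> F"
  using F by (auto simp: two_factor_def dest: symD)

lemma F_edge: "(u, v) \<in> F \<Longrightarrow> (u, v) \<in> E"
  using F by (auto simp: two_factor_def)

lemma card_F: "v \<in> X \<union> Y \<Longrightarrow> card (F `` {v}) = 2"
  using F by (auto simp: two_factor_def)

lemma finite_F: "finite (F `` {v})"
proof -
  have "F \<subseteq> E" using F by (simp add: two_factor_def)
  then show ?thesis using finite_E by (intro finite_Image) (rule finite_subset)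
qed

lemma reach_sym: "(u, v) \<in> F\<^sup>* \<Longrightarrow> (v, u) \<in> F\<^sup>*"
  using F by (auto simp: two_factor_def dest: symD[OF sym_rtrancl])

definition crossing :: "'a \<Rightarrow> 'a \<Rightarrow> bool" where
  "crossing x y \<longleftrightarrow> (x, y) \<in> E \<and> (x, y) \<notin> F\<^sup>*"

text \<open>For vertices of the graph, twins are opposite vertices of a 4-cycle of
  \<open>F\<close>.\<close>

definition twins :: "'a \<Rightarrow> 'a \<Rightarrow> bool" where
  "twins u v \<longleftrightarrow> u \<noteq> v \<and> F `` {u} = F `` {v}"

lemma crossing_sym: "crossing x y \<Longrightarrow> crossing y x"
  using edge_sym reach_sym by (auto simp: crossing_def)

lemma crossing_verts: "crossing x y \<Longrightarrow> x \<in> X \<union> Y" "crossing x y \<Longrightarrow> y \<in> X \<union> Y"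
  using edge_verts by (auto simp: crossing_def)

lemma F_subset_eq:
  assumes "u \<in> X \<union> Y" "v \<in> X \<union> Y" "F `` {u} \<subseteq> F `` {v}"
  shows "F `` {u} = F `` {v}"
  using assms card_F finite_F by (intro card_subset_eq) auto

lemma ex_F_nbr: "v \<in> X \<union> Y \<Longrightarrow> \<exists>a. (v, a) \<in> F"
  using card_F[of v] by (cases "F `` {v} = {}") auto

text \<open>An edge \<open>ab\<close> would allow the two cycles to be merged, contradicting the
  maximality of \<open>reach_count F\<close>.\<close>

lemma crossing_no_edge:
  assumes "crossing x y" "(x, a) \<in> F" "(y, b) \<in> F"
  shows "(a, b) \<notin> E"
proof
  assume "(a, b) \<in> E"
  then obtain F' where "two_factor F'" "F\<^sup>* \<subset> F'\<^sup>*"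
    using two_factor_merge[OF F] assms unfolding crossing_def by blast
  then show False using reach_count_strict_mono[OF F] max[of F'] by fastforce
qed

lemma crossing_nbrs_subset:
  assumes xy: "crossing x y" and xa: "(x, a) \<in> F"
  shows "E `` {y} - F `` {y} \<subseteq> E `` {a}"
proof -
  have "x \<in> E `` {y} \<inter> E `` {a}"
    using xy xa F_edge edge_sym by (auto simp: crossing_def)
  then have "card (E `` {y} - E `` {a}) \<le> 2" using S13_free by blast
  moreover have "F `` {y} \<subseteq> E `` {y} - E `` {a}"
    using crossing_no_edge[OF xy xa] F_edge by auto
  ultimately have "F `` {y} = E `` {y} - E `` {a}"
    using card_F[OF crossing_verts(2)[OF xy]] finite_nbrs by (intro card_seteq) auto
  then show ?thesis by blast
qed

text \<open>Any \<open>a\<close> in \<open>F\<close>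
  {x}\<open>is adjacent to\<close>z\<open>. Were\<close>az\<open>not in\<close>F\<open>, the crossing edge\<close>yz\<open>would make\<close>a\<open>adjacent to each\<close>b\<open>in\<close>F
  \<open>{y}\<close>, which \<open>crossing_no_edge\<close> forbids.\<close>

lemma crossing_twin_if_not_reach:
  assumes xy: "crossing x y" and z: "(y, z) \<in> E" "(y, z) \<notin> F\<^sup>*"
  shows "F `` {z} = F `` {x}"
proof -
  have "F `` {x} \<subseteq> F `` {z}"
  proof clarsimp
    fix a assume a: "(x, a) \<in> F"
    have "z \<in> E `` {a}" using crossing_nbrs_subset[OF xy a] z by auto
    show "(z, a) \<in> F"
    proof (rule ccontr)
      assume "(z, a) \<notin> F"
      moreover obtain b where b: "(y, b) \<in> F" using ex_F_nbr crossing_verts[OF xy] by blast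
      moreover have "crossing y z" using z by (simp add: crossing_def)
      ultimately have "a \<in> E `` {b}"
        using crossing_nbrs_subset[of y z b] \<open>z \<in> E `` {a}\<close> edge_sym by blast
      then show False using crossing_no_edge[OF xy a b] edge_sym by blast
    qed
  qed
  moreover have "x \<in> X \<union> Y" "z \<in> X \<union> Y" using z edge_verts crossing_verts[OF xy] by blast+
  ultimately show ?thesis using F_subset_eq by blast
qed

lemma card_nbrs_diff_F:
  assumes "v \<in> X \<union> Y"
  shows "2 \<le> card (E `` {v} - F `` {v})"
proof -
  have "card (E `` {v}) - card (F `` {v}) \<le> card (E `` {v} - F `` {v})"
    by (rule diff_card_le_card_Diff[OF finite_F])
  then show ?thesis using min_deg[OF assms] card_F[OF assms] by linarith
qed

lemma crossing_ex_twin: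
  assumes xy: "crossing x y"
  shows "\<exists>c. twins x c"
proof -
  have x: "x \<in> X \<union> Y" and y: "y \<in> X \<union> Y" by (rule crossing_verts[OF xy])+
  have "\<not> E `` {y} - F `` {y} \<subseteq> {x}"
    using card_nbrs_diff_F[OF y] card_mono[of "{x}" "E `` {y} - F `` {y}"] by auto
  then obtain z where z: "(y, z) \<in> E" "(y, z) \<notin> F" "z \<noteq> x" by auto
  show ?thesis
  proof (cases "(y, z) \<in> F\<^sup>*")
    case False
    then show ?thesis
      using crossing_twin_if_not_reach[OF xy z(1)] z(3) unfolding twins_def by metis
  next
    case True
    obtain a where a: "(x, a) \<in> F" using ex_F_nbr x by blast
    have nr: "(w, u) \<notin> F\<^sup>*" if "(x, w) \<in> F\<^sup>*" "(y, u) \<in> F\<^sup>*" for w u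
      using that xy reach_sym unfolding crossing_def by (meson rtrancl_trans)
    \<comment> \<open>The edge \<open>az\<close> is a second crossing edge between the same two
      cycles. It forces \<open>y\<close> to be adjacent to \<open>c\<close>, the other
      \<open>F\<close>-neighbour of \<open>a\<close>.\<close>
    have "crossing a z"
      using crossing_nbrs_subset[OF xy a] z nr[of a z] True a by (auto simp: crossing_def)
    have "card (F `` {a}) = 2" using card_F F_edge[OF a] edge_verts by blast
    then have "\<not> F `` {a} \<subseteq> {x}" using card_mono[of "{x}" "F `` {a}"] by auto
    then obtain c where c: "(a, c) \<in> F" "c \<noteq> x" by auto
    have "y \<in> E `` {c}"
      using crossing_nbrs_subset[OF \<open>crossing a z\<close> c(1)] z edge_sym F_sym by blast
    moreover have "(c, y) \<notin> F\<^sup>*"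
      using nr[of c y] a c(1) by (meson rtrancl.rtrancl_into_rtrancl rtrancl.rtrancl_refl)
    ultimately have "F `` {c} = F `` {x}"
      using crossing_twin_if_not_reach[OF xy] edge_sym reach_sym by blast
    then show ?thesis using c(2) unfolding twins_def by metis
  qed
qed

section \<open>Twin vertices and the 4-cycles of the optimal 2-factor\<close>

lemma twins_sym: "twins u v \<Longrightarrow> twins v u"
  by (auto simp: twins_def)

lemma F_nbr_of_twins:
  assumes "twins v w" "(v, a) \<in> F"
  shows "F `` {a} = {v, w}"
proof -
  have "{v, w} \<subseteq> F `` {a}" using assms F_sym by (auto simp: twins_def)
  moreover have "card (F `` {a}) = 2" using assms F_edge edge_verts card_F by blast
  moreover have "card {v, w} = 2" using assms by (simp add: twins_def)
  ultimately show ?thesis using finite_F card_subset_eq by metis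
qed

lemma twins_unique:
  assumes "twins v w" "twins v w'" "v \<in> X \<union> Y"
  shows "w = w'"
proof -
  obtain a where "(v, a) \<in> F" using ex_F_nbr assms(3) by blast
  then have "{v, w} = {v, w'}" using F_nbr_of_twins assms by metis
  then show ?thesis using assms by (auto simp: twins_def doubleton_eq_iff)
qed

lemma twins_verts: "twins v w \<Longrightarrow> v \<in> X \<union> Y \<Longrightarrow> w \<in> X \<union> Y"
  using ex_F_nbr[of v] F_edge edge_verts unfolding twins_def by blast

text \<open>Twins and their common \<open>F\<close>-neighbours are closed under \<open>F\<close>, so
  they make up the whole cycle.\<close>

lemma twins_reach_subset:
  assumes "twins v w"
  shows "F\<^sup>* `` {v} \<subseteq> {v, w} \<union> F `` {v}"
proof -
  have "F `` ({v, w} \<union> F `` {v}) \<subseteq> {v, w} \<union> F `` {v}"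
    using assms F_nbr_of_twins[OF assms] by (auto simp: twins_def)
  then have "F\<^sup>* `` ({v, w} \<union> F `` {v}) = {v, w} \<union> F `` {v}" by (rule Image_closed_trancl)
  then show ?thesis by blast
qed

text \<open>A chord of the 4-cycle through \<open>v\<close> would end in the twin of
  \<open>v\<close>, which lies on the same side of the bipartition.\<close>

lemma twins_F_if_reach:
  assumes vw: "twins v w" and vz: "(v, z) \<in> E" "(v, z) \<in> F\<^sup>*"
  shows "(v, z) \<in> F"
proof (rule ccontr)
  assume "(v, z) \<notin> F"
  then have "z = w" using twins_reach_subset[OF vw] vz edge_sides by auto
  moreover obtain a where "(v, a) \<in> F" using ex_F_nbr vz edge_verts by blast
  ultimately have "(v, a) \<in> E" "(z, a) \<in> E" using vw F_edge by (auto simp: twins_def)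
  then show False using vz(1) edge_sides by blast
qed

lemma crossing_nbrs_eq:
  assumes xy: "crossing x y" and a: "(x, a) \<in> F"
  shows "E `` {y} = F `` {y} \<union> F `` {a}"
proof -
  obtain y' where y': "twins y y'" using crossing_ex_twin crossing_sym[OF xy] by blast
  have "E `` {y} - F `` {y} \<subseteq> F `` {a}"
  proof
    fix z assume z: "z \<in> E `` {y} - F `` {y}"
    then have "(y, z) \<notin> F\<^sup>*" using twins_F_if_reach[OF y'] by blast
    then have "F `` {z} = F `` {x}" using crossing_twin_if_not_reach[OF xy] z by blast
    then show "z \<in> F `` {a}" using a F_sym by blast
  qed
  moreover have "card (F `` {a}) \<le> card (E `` {y} - F `` {y})"
    using card_nbrs_diff_F[OF crossing_verts(2)[OF xy]] card_F[of a] F_edge[OF a] edge_verts by simp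
  ultimately have "E `` {y} - F `` {y} = F `` {a}" using finite_F by (intro card_seteq) auto
  then show ?thesis using F_edge by blast
qed

text \<open>Twins spread along walks from \<open>x\<close>. After an edge of \<open>F\<close> the
  other \<open>F\<close>-neighbour \<open>c\<close> of \<open>u\<close> is the twin; after a
  crossing edge \<open>crossing_ex_twin\<close> applies.\<close>

lemma ex_twin_if_crossing:
  assumes xy: "crossing x y" and v: "v \<in> X \<union> Y"
  shows "\<exists>w. twins v w"
proof -
  have "(x, v) \<in> E\<^sup>*" using conn[OF crossing_verts(1)[OF xy] v] .
  then show ?thesis
  proof (induction rule: rtrancl_induct)
    case base
    show ?case using crossing_ex_twin[OF xy] .
  next
    case (step u v)
    then obtain u' where u': "twins u u'" by blast
    show ?case
    proof (cases "(u, v) \<in> F\<^sup>*")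
      case True
      then have uv: "(u, v) \<in> F" using twins_F_if_reach[OF u'] step by blast
      have "card (F `` {u}) = 2" using card_F step(2) edge_verts by blast
      then have "\<not> F `` {u} \<subseteq> {v}" using card_mono[of "{v}" "F `` {u}"] by auto
      then obtain c where c: "(u, c) \<in> F" "c \<noteq> v" by auto
      have "F `` {v} = F `` {c}"
        using F_nbr_of_twins[OF u' uv] F_nbr_of_twins[OF u' c(1)] by simp
      then show ?thesis using c unfolding twins_def by metis
    next
      case False
      then have "crossing u v" using step(2) by (simp add: crossing_def)
      then have "crossing v u" by (rule crossing_sym)
      then show ?thesis by (rule crossing_ex_twin)
    qed
  qed
qed

text \<open>A single crossing edge would confine every vertex to a 4-cycle of \<open>F\<close>,
  while a rearranged 2-factor \<open>F'\<close> lets every vertex reach at least six.\<close>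

lemma no_crossing: "\<not> crossing x y"
proof
  assume xy: "crossing x y"
  define \<tau> where "\<tau> v = (SOME w. twins v w)" for v
  have tw: "twins v (\<tau> v)" if "v \<in> X \<union> Y" for v
    using ex_twin_if_crossing[OF xy that] unfolding \<tau>_def by (rule someI_ex)
  have \<tau>V: "\<tau> v \<in> X \<union> Y" if "v \<in> X \<union> Y" for v using twins_verts tw that by blast
  have \<tau>\<tau>: "\<tau> (\<tau> v) = v" if "v \<in> X \<union> Y" for v
    using twins_unique[OF tw[OF \<tau>V[OF that]] twins_sym[OF tw[OF that]] \<tau>V[OF that]] .
  have \<tau>_neq: "\<tau> v \<noteq> v" if "v \<in> X \<union> Y" for v using tw[OF that] by (auto simp: twins_def)
  have F_pair: "F `` {v} = {p, \<tau> p}" if "(v, p) \<in> F" for v p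
    using that F_nbr_of_twins[of p "\<tau> p" v] tw F_sym F_edge edge_verts by blast
  have ex_cross: "\<exists>z. crossing v z" if v: "v \<in> X \<union> Y" for v
  proof -
    have "E `` {v} - F `` {v} \<noteq> {}" using card_nbrs_diff_F[OF v] by force
    then show ?thesis using twins_F_if_reach[OF tw[OF v]] unfolding crossing_def by blast
  qed
  \<comment> \<open>If \<open>z\<close> is joined to \<open>v\<close> by a crossing edge,
    \<open>crossing_nbrs_eq\<close> also joins it to the twin of \<open>v\<close>. The same lemma,
    read from \<open>z\<close>, then gives both twins the same neighbourhood.\<close>
  have E_\<tau>: "E `` {\<tau> v} = E `` {v}" if v: "v \<in> X \<union> Y" for v
  proof -
    obtain z where z: "crossing v z" using ex_cross v by blast
    obtain b where b: "(v, b) \<in> F" using ex_F_nbr v by blast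
    obtain a where a: "(z, a) \<in> F" using ex_F_nbr crossing_verts[OF z] by blast
    have 1: "F `` {b} = {v, \<tau> v}" using F_nbr_of_twins[OF tw[OF v] b] .
    then have "(z, \<tau> v) \<in> E" using crossing_nbrs_eq[OF z b] by blast
    moreover have "(z, \<tau> v) \<notin> F\<^sup>*"
    proof
      assume "(z, \<tau> v) \<in> F\<^sup>*"
      moreover have "(\<tau> v, b) \<in> F" using 1 F_sym by blast
      ultimately have "(z, v) \<in> F\<^sup>*" using F_sym[OF b] by (meson rtrancl.rtrancl_into_rtrancl)
      then show False using crossing_sym[OF z] by (simp add: crossing_def)
    qed
    ultimately have "crossing z (\<tau> v)" by (simp add: crossing_def)
    then have "E `` {\<tau> v} = F `` {\<tau> v} \<union> F `` {a}" using a by (rule crossing_nbrs_eq)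
    moreover have "E `` {v} = F `` {v} \<union> F `` {a}"
      using crossing_sym[OF z] a by (rule crossing_nbrs_eq)
    ultimately show ?thesis using tw[OF v] by (simp add: twins_def)
  qed
  \<comment> \<open>\<open>E\<close> is a blow-up of a cycle with all vertices doubled. Keeping only the edges inside a
    transversal \<open>A\<close> of the twin pairs and inside its complement gives a 2-factor with two long
    cycles.\<close>
  define r where "r v = (SOME w. w \<in> {v, \<tau> v})" for v
  have r: "r v \<in> {v, \<tau> v}" for v unfolding r_def by (rule someI_ex) blast
  \<comment> \<open>The choice depends only on the set \<open>{v, \<tau> v}\<close>, so twins select
    the same representative and exactly one of them is in \<open>A\<close>.\<close>
  have r\<tau>: "r (\<tau> v) = r v" if "v \<in> X \<union> Y" for v
    unfolding r_def \<tau>\<tau>[OF that] by (simp add: insert_commute)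
  define A where "A = {v. r v = v}"
  have A\<tau>: "\<tau> v \<in> A \<longleftrightarrow> v \<notin> A" if "v \<in> X \<union> Y" for v
    using r[of v] r\<tau>[OF that] \<tau>_neq[OF that] by (auto simp: A_def)
  define F' where "F' = {(u, v) \<in> E. u \<in> A \<longleftrightarrow> v \<in> A}"
  have card1: "card ({p, \<tau> p} \<inter> {u. P \<longleftrightarrow> u \<in> A}) = 1" if "p \<in> X \<union> Y" for p P
  proof -
    have "{p, \<tau> p} \<inter> {u. P \<longleftrightarrow> u \<in> A} = {if P \<longleftrightarrow> p \<in> A then p else \<tau> p}"
      using A\<tau>[OF that] by auto
    then show ?thesis by simp
  qed
  have F': "two_factor F'"
    unfolding two_factor_def
  proof (intro conjI ballI)
    show "F' \<subseteq> E" by (auto simp: F'_def)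
    show "sym F'" using edge_sym by (auto simp: F'_def sym_def)
    fix v assume v: "v \<in> X \<union> Y"
    obtain z where z: "crossing z v" using ex_cross[OF v] crossing_sym by blast
    obtain a where a: "(z, a) \<in> F" using ex_F_nbr crossing_verts[OF z] by blast
    obtain p where p: "(v, p) \<in> F" using ex_F_nbr v by blast
    \<comment> \<open>The neighbourhood of \<open>v\<close> splits into two disjoint twin pairs, and
      each pair has exactly one vertex on the same side of \<open>A\<close> as
      \<open>v\<close>.\<close>
    have Ev: "E `` {v} = F `` {v} \<union> F `` {a}" using crossing_nbrs_eq[OF z a] .
    have Fv: "F `` {v} = {p, \<tau> p}" using F_pair[OF p] .
    have Fa: "F `` {a} = {z, \<tau> z}" using F_pair[OF F_sym[OF a]] .
    have "F `` {v} \<inter> F `` {a} = {}"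
    proof (rule ccontr)
      assume "F `` {v} \<inter> F `` {a} \<noteq> {}"
      then obtain q where "(v, q) \<in> F" "(a, q) \<in> F" by auto
      then have "(z, v) \<in> F\<^sup>*" using a F_sym by (meson r_into_rtrancl rtrancl_trans)
      then show False using z by (simp add: crossing_def)
    qed
    moreover have "F' `` {v} = (F `` {v} \<inter> {u. v \<in> A \<longleftrightarrow> u \<in> A}) \<union> (F `` {a} \<inter> {u. v \<in> A \<longleftrightarrow> u \<in> A})"
      using Ev by (auto simp: F'_def)
    ultimately have "card (F' `` {v}) = card (F `` {v} \<inter> {u. v \<in> A \<longleftrightarrow> u \<in> A}) +
        card (F `` {a} \<inter> {u. v \<in> A \<longleftrightarrow> u \<in> A})"
      using finite_F by (simp only:) (rule card_Un_disjoint; auto)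
    also have "\<dots> = 2"
      unfolding Fv Fa using card1 F_edge[OF p] edge_verts crossing_verts[OF z]
      by (metis one_add_one)
    finally show "card (F' `` {v}) = 2" .
  qed
  have reach': "{w \<in> X \<union> Y. v \<in> A \<longleftrightarrow> w \<in> A} \<subseteq> F'\<^sup>* `` {v}" if v: "v \<in> X \<union> Y" for v
  proof -
    \<comment> \<open>\<open>s\<close> moves every vertex to the member of its twin pair on the side
      of \<open>v\<close>. Since twins have equal neighbourhoods, it maps walks in \<open>E\<close>
      to walks in \<open>F'\<close>.\<close>
    define s where "s u = (if v \<in> A \<longleftrightarrow> u \<in> A then u else \<tau> u)" for u
    have sA: "s u \<in> A \<longleftrightarrow> v \<in> A" if "u \<in> X \<union> Y" for u
      using A\<tau>[OF that] by (auto simp: s_def)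
    have sE: "E `` {s u} = E `` {u}" if "u \<in> X \<union> Y" for u
      using E_\<tau>[OF that] by (auto simp: s_def)
    have step: "(s u, s w) \<in> F'" if uw: "(u, w) \<in> E" for u w
    proof -
      have V: "u \<in> X \<union> Y" "w \<in> X \<union> Y" using edge_verts uw by auto
      have "(s u, w) \<in> E" using sE[OF V(1)] uw by blast
      then have "(s u, s w) \<in> E" using sE[OF V(2)] edge_sym by blast
      then show ?thesis using sA V by (simp add: F'_def)
    qed
    have "(s v, s w) \<in> F'\<^sup>*" if "(v, w) \<in> E\<^sup>*" for w
      using that by (induction rule: rtrancl_induct) (auto intro: rtrancl_into_rtrancl step)
    moreover have "s v = v" by (simp add: s_def)
    moreover have "s w = w" if "v \<in> A \<longleftrightarrow> w \<in> A" for w using that by (simp add: s_def)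
    ultimately have "(v, w) \<in> F'\<^sup>*" if "w \<in> X \<union> Y" "v \<in> A \<longleftrightarrow> w \<in> A" for w
      using conn[OF v that(1)] that(2) by metis
    then show ?thesis by blast
  qed
  have finV: "finite (X \<union> Y)" using finite_X finite_Y by simp
  have six: "6 \<le> card (E `` {a} \<union> F `` {y})" if "crossing x y" "(x, a) \<in> F" for x y a
  proof -
    have "E `` {a} \<inter> F `` {y} = {}" using crossing_no_edge[OF that] by blast
    then have "card (E `` {a} \<union> F `` {y}) = card (E `` {a}) + card (F `` {y})"
      using finite_F finite_nbrs by (intro card_Un_disjoint) auto
    moreover have "4 \<le> card (E `` {a})" using min_deg F_edge[OF that(2)] edge_verts by blast
    ultimately show ?thesis using card_F[OF crossing_verts(2)[OF that(1)]] by simp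
  qed
  obtain a where a: "(x, a) \<in> F" using ex_F_nbr crossing_verts[OF xy] by blast
  obtain b where b: "(y, b) \<in> F" using ex_F_nbr crossing_verts[OF xy] by blast
  have "12 \<le> card (X \<union> Y)"
  proof -
    \<comment> \<open>\<open>?P\<close> lies on the side of \<open>x\<close> and \<open>?Q\<close>
      on the side of \<open>y\<close>, so both sides have at least six vertices.\<close>
    let ?P = "E `` {a} \<union> F `` {y}" and ?Q = "E `` {b} \<union> F `` {x}"
    have sides: "x \<in> X \<longleftrightarrow> y \<notin> X" "x \<in> X \<longleftrightarrow> a \<notin> X" "y \<in> X \<longleftrightarrow> b \<notin> X"
      using xy edge_sides[of x y] edge_sides[OF F_edge[OF a]] edge_sides[OF F_edge[OF b]]
      by (simp_all add: crossing_def)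
    have "u \<in> X \<longleftrightarrow> x \<in> X" if "u \<in> ?P" for u
    proof -
      have "(a, u) \<in> E \<or> (y, u) \<in> E" using that F_edge by blast
      then show ?thesis using sides edge_sides[of a u] edge_sides[of y u] by blast
    qed
    moreover have "u \<in> X \<longleftrightarrow> y \<in> X" if "u \<in> ?Q" for u
    proof -
      have "(b, u) \<in> E \<or> (x, u) \<in> E" using that F_edge by blast
      then show ?thesis using sides edge_sides[of b u] edge_sides[of x u] by blast
    qed
    ultimately have "?P \<inter> ?Q = {}" using sides(1) by blast
    then have "card (?P \<union> ?Q) = card ?P + card ?Q"
      using finite_F finite_nbrs by (intro card_Un_disjoint) auto
    moreover have "?P \<union> ?Q \<subseteq> X \<union> Y" using F_edge edge_verts(2) by blast
    then have "card (?P \<union> ?Q) \<le> card (X \<union> Y)" using finV card_mono by blast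
    ultimately show ?thesis using six[OF xy a] six[OF crossing_sym[OF xy] b] by linarith
  qed
  have half: "6 \<le> card {w \<in> X \<union> Y. P \<longleftrightarrow> w \<in> A}" for P
  proof -
    let ?C = "\<lambda>P. {w \<in> X \<union> Y. P \<longleftrightarrow> w \<in> A}"
    \<comment> \<open>The twin map exchanges \<open>A\<close> and its complement, so each contains
      half of the vertices.\<close>
    have "card (?C P) = card (?C (\<not> P))"
    proof (rule bij_betw_same_card)
      show "bij_betw \<tau> (?C P) (?C (\<not> P))"
        by (rule bij_betwI[of _ _ _ \<tau>]) (use \<tau>V \<tau>\<tau> A\<tau> in auto)
    qed
    moreover have "card (?C P \<union> ?C (\<not> P)) = card (?C P) + card (?C (\<not> P))"
      using finV by (intro card_Un_disjoint) auto
    moreover have "?C P \<union> ?C (\<not> P) = X \<union> Y" by auto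
    ultimately show ?thesis using \<open>12 \<le> card (X \<union> Y)\<close> by simp
  qed
  have "reach_count F < reach_count F'"
    unfolding reach_count_def
  proof (rule sum_strict_mono)
    show "finite (X \<union> Y)" by (rule finV)
    show "X \<union> Y \<noteq> {}" using crossing_verts[OF xy] by blast
    fix v assume v: "v \<in> X \<union> Y"
    have "card (F\<^sup>* `` {v}) \<le> card ({v, \<tau> v} \<union> F `` {v})"
      using twins_reach_subset[OF tw[OF v]] finite_F by (intro card_mono) auto
    also have "\<dots> \<le> card {v, \<tau> v} + card (F `` {v})" by (rule card_Un_le)
    also have "\<dots> \<le> 4" using card_F[OF v] card_insert_le_m1[of 2 "{\<tau> v}" v] by simp
    also have "\<dots> < card {w \<in> X \<union> Y. v \<in> A \<longleftrightarrow> w \<in> A}" using half[of "v \<in> A"] by simp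
    also have "\<dots> \<le> card (F'\<^sup>* `` {v})"
      using reach'[OF v] two_factor_reach_subset[OF F' v] finV
      by (meson card_mono finite_subset)
    finally show "card (F\<^sup>* `` {v}) < card (F'\<^sup>* `` {v})" .
  qed
  then show False using max[OF F'] by simp
qed

lemma edges_subset_reach: "E \<subseteq> F\<^sup>*"
proof clarify
  fix u v assume "(u, v) \<in> E"
  then show "(u, v) \<in> F\<^sup>*" using no_crossing[of u v] by (simp add: crossing_def)
qed

end

text \<open>A 2-factor maximising the bounded \<open>reach_count\<close> has no crossing edges, so
  each of its components is a component of the connected graph.\<close>

lemma ex_connected_two_factor:
  "\<exists>F. two_factor F \<and> (\<forall>u\<in>X \<union> Y. \<forall>v\<in>X \<union> Y. (u, v) \<in> F\<^sup>*)"
proof -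
  have bound: "reach_count F \<le> card (X \<union> Y) * card (X \<union> Y)" if "two_factor F" for F
    unfolding reach_count_def
    using two_factor_reach_subset[OF that] finite_X finite_Y
    by (intro sum_bounded_above[THEN order_trans]) (auto intro: card_mono)
  obtain F where F: "two_factor F" "\<And>F'. two_factor F' \<Longrightarrow> reach_count F' \<le> reach_count F"
    using ex_two_factor bound
      ex_has_greatest_nat[of two_factor _ reach_count "card (X \<union> Y) * card (X \<union> Y) + 1"]
    by (metis less_Suc_eq_le Suc_eq_plus1)
  have "E \<subseteq> F\<^sup>*" by (rule edges_subset_reach) (use F in auto)
  then have "E\<^sup>* \<subseteq> F\<^sup>*" using rtrancl_subset_rtrancl by blast
  then show ?thesis using F(1) conn by blast
qed

end

section \<open>From a connected two-factor to a Hamilton cycle\<close>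

text \<open>Hall's condition follows by counting: \<open>2 * card S\<close> edges of
  \<open>F\<close> leave \<open>S\<close>, and each vertex of \<open>T\<close> receives at most
  two.\<close>

lemma (in bipartite_graph) two_factor_matching:
  assumes F: "two_factor F"
  shows "\<exists>f. inj_on f X \<and> (\<forall>x\<in>X. (x, f x) \<in> F)"
proof -
  have FE: "F \<subseteq> E" and symF: "sym F" and card2: "\<And>v. v \<in> X \<union> Y \<Longrightarrow> card (F `` {v}) = 2"
    using F by (auto simp: two_factor_def)
  have finF: "finite F" using FE finite_E by (rule finite_subset)
  have "\<exists>f. inj_on f X \<and> (\<forall>x\<in>X. f x \<in> F `` {x})"
  proof (rule hall_marriage[OF finite_X])
    show "finite (F `` {x})" for x using finF by (rule finite_Image)
    fix S assume S: "S \<subseteq> X"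
    define T where "T = (\<Union>x\<in>S. F `` {x})"
    have TY: "T \<subseteq> Y" using S FE nbrs_X unfolding T_def by blast
    have finS: "finite S" and finT: "finite T"
      using S TY finite_X finite_Y by (auto intro: finite_subset)
    have "2 * card S = (\<Sum>x\<in>S. card (F `` {x}))"
      using card2 S by (simp add: subset_iff)
    also have "\<dots> = card (F \<inter> S \<times> T)"
      using finS finF by (intro card_Int_Times_eq_sum[symmetric] finite_Image) (auto simp: T_def)
    also have "\<dots> = card (F \<inter> T \<times> S)"
      using card_converse_Int[of F T S] symF by (simp add: sym_conv_converse_eq)
    also have "\<dots> \<le> card (F \<inter> T \<times> X)"
      using finF S by (intro card_mono) auto
    also have "\<dots> = (\<Sum>y\<in>T. card (F `` {y}))"
      using finT finF FE TY nbrs_Y by (intro card_Int_Times_eq_sum finite_Image) blast+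
    also have "\<dots> = 2 * card T"
      using card2 TY by (simp add: subset_iff)
    finally show "card S \<le> card (\<Union>x\<in>S. F `` {x})" by (simp add: T_def)
  qed
  then show ?thesis by simp
qed

text \<open>At the first repetition \<open>w i = w m\<close>, a positive \<open>i\<close> could be
  lowered together with \<open>m\<close> by injectivity, giving an earlier repetition; hence
  \<open>i = 0\<close>.\<close>

lemma ex_orbit_period:
  assumes fin: "finite A" and inj: "inj_on \<sigma> A" and \<sigma>A: "\<sigma> ` A \<subseteq> A" and x: "x \<in> A"
  shows "\<exists>m>0. (\<sigma> ^^ m) x = x \<and> inj_on (\<lambda>i. (\<sigma> ^^ i) x) {..<m}"
proof -
  define w where "w i = (\<sigma> ^^ i) x" for i
  have wA: "w i \<in> A" for i by (induction i) (use x \<sigma>A in \<open>auto simp: w_def\<close>)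
  define P where "P j \<longleftrightarrow> (\<exists>i<j. w i = w j)" for j
  have "\<not> inj w"
    using wA fin finite_subset[of "range w" A] by (meson finite_imageD image_subsetI infinite_UNIV_nat)
  then have "\<exists>j. P j" by (metis P_def injI linorder_less_linear)
  then obtain m where m: "P m" "\<And>j. j < m \<Longrightarrow> \<not> P j" by (metis LeastI not_less_Least)
  then obtain i where i: "i < m" "w i = w m" by (auto simp: P_def)
  have "i = 0"
  proof (rule ccontr)
    assume "i \<noteq> 0"
    then obtain k l where kl: "i = Suc k" "m = Suc l" using i(1) by (metis less_nat_zero_code not0_implies_Suc)
    then have "\<sigma> (w k) = \<sigma> (w l)" using i(2) by (simp add: w_def)
    then have "w k = w l" using inj wA by (meson inj_onD)
    then have "P l" using i(1) kl by (auto simp: P_def)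
    then show False using m(2)[of l] kl by simp
  qed
  moreover have "inj_on w {..<m}"
    using m(2) unfolding P_def inj_on_def by (metis lessThan_iff linorder_less_linear)
  ultimately show ?thesis
    using i unfolding w_def by (intro exI[of _ m]) simp
qed

text \<open>A matching \<open>f\<close> inside \<open>F\<close> gives the cycle a direction: from
  \<open>x\<close> go to \<open>f x\<close>, then to its other \<open>F\<close>-neighbour
  \<open>\<sigma> x\<close>. The vertices met this way are closed under \<open>F\<close>, so by
  connectivity they are all vertices.\<close>

lemma (in bipartite_graph) connected_two_factor_sequence:
  assumes F: "two_factor F" and conn: "\<And>u v. u \<in> X \<union> Y \<Longrightarrow> v \<in> X \<union> Y \<Longrightarrow> (u, v) \<in> F\<^sup>*"
    and ne: "X \<noteq> {}"
  shows "\<exists>v n. 3 \<le> n \<and> v n = v 0 \<and> inj_on v {..<n} \<and> v ` {..<n} = X \<union> Y \<and>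
    (\<forall>k<n. (v k, v (Suc k)) \<in> E)"
proof -
  have FE: "F \<subseteq> E" and symF: "sym F" and card2: "\<And>v. v \<in> X \<union> Y \<Longrightarrow> card (F `` {v}) = 2"
    using F by (auto simp: two_factor_def)
  obtain f where f: "inj_on f X" "\<And>x. x \<in> X \<Longrightarrow> (x, f x) \<in> F"
    using two_factor_matching[OF F] by blast
  have fY: "f x \<in> Y" if "x \<in> X" for x using f(2)[OF that] FE nbrs_X that by blast
  have "\<exists>z. z \<noteq> x \<and> F `` {f x} = {x, z}" if "x \<in> X" for x
  proof -
    have "card (F `` {f x}) = 2" using card2 fY that by blast
    then obtain p q where pq: "F `` {f x} = {p, q}" "p \<noteq> q" unfolding card_2_iff by blast
    have "x \<in> F `` {f x}" using f(2)[OF that] symF by (auto dest: symD)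
    then have "x = p \<or> x = q" unfolding pq(1) by blast
    then show ?thesis using pq by auto
  qed
  then obtain \<sigma> where \<sigma>: "\<And>x. x \<in> X \<Longrightarrow> \<sigma> x \<noteq> x" "\<And>x. x \<in> X \<Longrightarrow> F `` {f x} = {x, \<sigma> x}"
    by metis
  have \<sigma>X: "\<sigma> x \<in> X" if "x \<in> X" for x
    using \<sigma>(2)[OF that] FE nbrs_Y[OF fY[OF that]] by blast
  have F\<sigma>: "F `` {\<sigma> x} = {f (\<sigma> x), f x}" if x: "x \<in> X" for x
  proof (rule card_subset_eq[symmetric])
    show "finite (F `` {\<sigma> x})" using FE finite_E by (intro finite_Image) (rule finite_subset)
    have "(\<sigma> x, f x) \<in> F" using \<sigma>(2)[OF x] symF by (auto dest: symD)
    then show "{f (\<sigma> x), f x} \<subseteq> F `` {\<sigma> x}" using f(2)[OF \<sigma>X[OF x]] by simp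
    have "f (\<sigma> x) \<noteq> f x" using f(1) \<sigma>(1) \<sigma>X x by (meson inj_onD)
    then show "card {f (\<sigma> x), f x} = card (F `` {\<sigma> x})" using card2 \<sigma>X x by simp
  qed
  have inj\<sigma>: "inj_on \<sigma> X"
  proof (rule inj_onI)
    fix x x' assume x: "x \<in> X" "x' \<in> X" "\<sigma> x = \<sigma> x'"
    then have "{f (\<sigma> x), f x} = {f (\<sigma> x), f x'}" using F\<sigma> by metis
    then have "f x = f x'" by (auto simp: doubleton_eq_iff)
    then show "x = x'" using f(1) x by (meson inj_onD)
  qed
  obtain x0 where x0: "x0 \<in> X" using ne by blast
  define w where "w i = (\<sigma> ^^ i) x0" for i
  have wSuc: "w (Suc i) = \<sigma> (w i)" for i by (simp add: w_def)
  have wX: "w i \<in> X" for i by (induction i) (use x0 \<sigma>X in \<open>auto simp: w_def\<close>)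
  obtain m where m: "m > 0" "w m = w 0" "inj_on w {..<m}"
    using ex_orbit_period[OF finite_X inj\<sigma> _ x0] \<sigma>X unfolding w_def by auto
  \<comment> \<open>\<open>\<sigma>\<close> has no fixed point, so the sequence has length
    \<open>2 * m \<ge> 4\<close>.\<close>
  have "m \<noteq> 1" using m(2) wSuc[of 0] \<sigma>(1)[OF wX[of 0]] by auto
  then have m2: "2 \<le> m" using m(1) by simp
  \<comment> \<open>The sequence interleaves the orbit of \<open>\<sigma>\<close> at even indices
    with the matched vertices at odd ones.\<close>
  define v where "v k = (if even k then w (k div 2) else f (w (k div 2)))" for k
  have v_img: "v ` {..<2 * m} = w ` {..<m} \<union> f ` w ` {..<m}"
  proof
    show "v ` {..<2 * m} \<subseteq> w ` {..<m} \<union> f ` w ` {..<m}" by (auto simp: v_def)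
    have "w i \<in> v ` {..<2 * m}" if "i < m" for i
      by (rule image_eqI[of _ _ "2 * i"]) (use that in \<open>auto simp: v_def\<close>)
    moreover have "f (w i) \<in> v ` {..<2 * m}" if "i < m" for i
      by (rule image_eqI[of _ _ "2 * i + 1"]) (use that in \<open>auto simp: v_def\<close>)
    ultimately show "w ` {..<m} \<union> f ` w ` {..<m} \<subseteq> v ` {..<2 * m}" by auto
  qed
  have w_succ: "\<sigma> (w i) \<in> w ` {..<m}" if "i < m" for i
  proof (cases "Suc i = m")
    case True
    then have "\<sigma> (w i) = w 0" using m(2) wSuc[of i] by simp
    then show ?thesis using m(1) by (simp add: image_eqI[of _ _ 0])
  next
    case False
    then show ?thesis using that by (intro image_eqI[of _ _ "Suc i"]) (auto simp: wSuc)
  qed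
  have w_pred: "\<exists>j<m. w i = \<sigma> (w j)" if "i < m" for i
  proof (cases i)
    case 0
    then show ?thesis using m wSuc[of "m - 1"] by (intro exI[of _ "m - 1"]) auto
  next
    case (Suc j)
    then show ?thesis using that by (intro exI[of _ j]) (simp add: wSuc)
  qed
  have closed: "F `` (v ` {..<2 * m}) \<subseteq> v ` {..<2 * m}"
  proof -
    have "F `` {w i} \<subseteq> f ` w ` {..<m}" if i: "i < m" for i
    proof -
      obtain j where j: "j < m" "w i = \<sigma> (w j)" using w_pred i by blast
      then have "F `` {w i} = {f (w i), f (w j)}" using F\<sigma>[OF wX[of j]] by simp
      then show ?thesis using i j(1) by simp
    qed
    moreover have "F `` {f (w i)} \<subseteq> w ` {..<m}" if i: "i < m" for i
      using \<sigma>(2)[OF wX[of i]] w_succ i by auto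
    ultimately show ?thesis unfolding v_img by blast
  qed
  have img: "v ` {..<2 * m} = X \<union> Y"
  proof
    show "v ` {..<2 * m} \<subseteq> X \<union> Y" using wX fY unfolding v_img by blast
    have "F\<^sup>* `` (v ` {..<2 * m}) = v ` {..<2 * m}" using closed by (rule Image_closed_trancl)
    moreover have "w 0 \<in> v ` {..<2 * m}" using m(1) unfolding v_img by blast
    ultimately show "X \<union> Y \<subseteq> v ` {..<2 * m}" using conn[of "w 0"] wX[of 0] by blast
  qed
  have inj: "inj_on v {..<2 * m}"
  proof (rule inj_onI)
    fix k l assume kl: "k \<in> {..<2 * m}" "l \<in> {..<2 * m}" "v k = v l"
    have par: "even k \<longleftrightarrow> v k \<in> X" for k
      using wX fY disjoint by (auto simp: v_def)
    have "even k \<longleftrightarrow> even l" using par kl(3) by simp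
    moreover from this have "w (k div 2) = w (l div 2)"
      using kl(3) f(1) wX by (auto simp: v_def dest: inj_onD split: if_splits)
    then have "k div 2 = l div 2" using m(3) kl by (auto dest: inj_onD)
    ultimately show "k = l" by (metis even_iff_mod_2_eq_zero mod_div_mult_eq parity_cases)
  qed
  have "(v k, v (Suc k)) \<in> E" for k
  proof (cases "even k")
    case True
    then show ?thesis using f(2)[OF wX] FE by (auto simp: v_def)
  next
    case False
    then have "v k = f (w (k div 2))" "v (Suc k) = \<sigma> (w (k div 2))"
      by (auto simp: v_def wSuc elim!: oddE)
    then show ?thesis using \<sigma>(2)[OF wX[of "k div 2"]] FE by auto
  qed
  moreover have "v (2 * m) = v 0" using m(2) by (simp add: v_def)
  ultimately show ?thesis using inj img m2 by (intro exI[of _ v] exI[of _ "2 * m"]) auto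
qed

section \<open>Cyclic vertex sequences as closed arc walks\<close>

lemma pcas_map_upt:
  "i \<le> j \<Longrightarrow> pcas (v i) (map (\<lambda>k. (v k, v (Suc k))) [i..<j]) (v j)"
  by (induction rule: inc_induct) (simp_all add: upt_conv_Cons)

lemma pawalk_verts_map_upt:
  "i \<le> j \<Longrightarrow> pawalk_verts (v i) (map (\<lambda>k. (v k, v (Suc k))) [i..<j]) = map v [i..<Suc j]"
  by (induction rule: inc_induct) (simp_all add: upt_conv_Cons)

lemma hamilton_cycle_map_upt:
  fixes G :: "'a pair_pre_digraph"
  assumes n: "3 \<le> n" and closed: "v n = v 0" and inj: "inj_on v {..<n}"
    and img: "v ` {..<n} = pverts G" and arcs: "\<And>k. k < n \<Longrightarrow> (v k, v (Suc k)) \<in> parcs G"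
  shows "hamilton_cycle G (map (\<lambda>k. (v k, v (Suc k))) [0..<n])"
proof -
  let ?p = "map (\<lambda>k. (v k, v (Suc k))) [0..<n]"
  \<comment> \<open>\<open>cycle\<close> asks for distinct vertices after the first one, that is at
    the indices \<open>1\<close> to \<open>n\<close>; reading index \<open>n\<close> as
    \<open>0\<close> reduces this to \<open>inj\<close>.\<close>
  have "inj_on v {1..n}"
  proof (rule inj_onI)
    fix k l assume kl: "k \<in> {1..n}" "l \<in> {1..n}" "v k = v l"
    define r where "r i = (if i = n then 0 else i)" for i
    have "v (r i) = v i" for i using closed by (simp add: r_def)
    then have "v (r k) = v (r l)" using kl(3) by simp
    moreover have "r k < n" "r l < n" using kl n by (auto simp: r_def)
    ultimately have "r k = r l" using inj by (auto dest: inj_onD)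
    then show "k = l" using kl by (auto simp: r_def split: if_splits)
  qed
  moreover have "set [Suc 0..<Suc n] = {1..n}" by auto
  ultimately have "distinct (map v [Suc 0..<Suc n])"
    by (simp only: distinct_map distinct_upt)
  then have "distinct (tl (pawalk_verts (v 0) ?p))"
    by (simp only: pawalk_verts_map_upt[OF le0] map_tl[symmetric] tl_upt)
  moreover have "pcas (v 0) ?p (v 0)" using pcas_map_upt[of 0 n v] closed by simp
  moreover have "v 0 \<in> pverts G" using img n by force
  moreover have "set ?p \<subseteq> parcs G" using arcs by auto
  moreover have "?p \<noteq> []" using n by simp
  ultimately have "pre_digraph.cycle G ?p"
    unfolding pre_digraph.cycle_def pre_digraph.awalk_def cas_with_proj_eq
      awalk_verts_with_proj_eq with_proj_simps by blast
  moreover have "fst ` set ?p = pverts G" using img by (auto simp: image_image lessThan_atLeast0)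
  ultimately show ?thesis using n by (simp add: hamilton_cycle_def)
qed

section \<open>Induced copies of the forbidden graph\<close>

text \<open>A common neighbour \<open>c\<close> and three neighbours of \<open>u\<close> not
  adjacent to \<open>v\<close> yield the copy: \<open>u\<close> is the centre and \<open>v\<close>,
  \<open>c\<close> form the \<open>K(1,1)\<close>. Bipartiteness excludes all further edges.\<close>

lemma (in bipartite_graph) induced_S13:
  fixes G :: "'a pair_pre_digraph"
  assumes G: "pair_wf_digraph G" "parcs G = E" "pverts G = X \<union> Y"
    and common: "E `` {u} \<inter> E `` {v} \<noteq> {}" and big: "3 \<le> card (E `` {u} - E `` {v})"
  shows "\<not> induced_free S13 G"
proof -
  obtain c where c: "(u, c) \<in> E" "(v, c) \<in> E" using common by blast
  obtain T where T: "T \<subseteq> E `` {u} - E `` {v}" "card T = 3"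
    using big by (meson obtain_subset_with_card_n)
  obtain l1 l2 l3 where l: "T = {l1, l2, l3}" "l1 \<noteq> l2" "l1 \<noteq> l3" "l2 \<noteq> l3"
    using T(2) by (auto simp: card_3_iff)
  have ul: "(u, l1) \<in> E" "(u, l2) \<in> E" "(u, l3) \<in> E"
    and vl: "(v, l1) \<notin> E" "(v, l2) \<notin> E" "(v, l3) \<notin> E"
    using T(1) l by auto
  have sides: "c \<in> X \<longleftrightarrow> u \<notin> X" "v \<in> X \<longleftrightarrow> u \<in> X"
      "l1 \<in> X \<longleftrightarrow> u \<notin> X" "l2 \<in> X \<longleftrightarrow> u \<notin> X" "l3 \<in> X \<longleftrightarrow> u \<notin> X"
    using edge_sides[OF c(1)] edge_sides[OF c(2)] edge_sides[OF ul(1)] edge_sides[OF ul(2)]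
      edge_sides[OF ul(3)] by auto
  have "u \<noteq> v" "c \<noteq> l1" "c \<noteq> l2" "c \<noteq> l3" using ul vl c by auto
  moreover have "c \<noteq> u" "c \<noteq> v" "l1 \<noteq> u" "l1 \<noteq> v" "l2 \<noteq> u" "l2 \<noteq> v" "l3 \<noteq> u" "l3 \<noteq> v"
    using sides by auto
  ultimately have dist: "distinct [v, c, u, l1, l2, l3]" using l by auto
  define S where "S = {v, c, u, l1, l2, l3}"
  have SV: "S \<subseteq> X \<union> Y" using edge_verts c ul by (auto simp: S_def)
  \<comment> \<open>Each edge of the copy occurs once, in the direction used by \<open>E\<close> in
    the definition of \<open>S13\<close>.\<close>
  define A where "A = {(v, c), (c, u), (u, l1), (u, l2), (u, l3)}"
  have arcs: "E \<inter> S \<times> S = A \<union> A\<inverse>"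
  proof
    have "A \<subseteq> E" using c(2) edge_sym[OF c(1)] ul by (simp add: A_def)
    moreover from this have "A\<inverse> \<subseteq> E" using edge_sym by blast
    moreover have "A \<subseteq> S \<times> S" by (simp add: A_def S_def)
    ultimately show "A \<union> A\<inverse> \<subseteq> E \<inter> S \<times> S" by blast
    have half: "(p, q) \<in> A \<union> A\<inverse>"
      if pq: "(p, q) \<in> E" "p \<in> S" "q \<in> S" and p: "p \<in> X \<longleftrightarrow> u \<in> X" for p q
    proof -
      have "q \<in> X \<longleftrightarrow> u \<notin> X" using p edge_sides[OF pq(1)] by blast
      then have "q = c \<or> q = l1 \<or> q = l2 \<or> q = l3" using pq(3) sides by (auto simp: S_def)
      moreover have "p = u \<or> p = v" using pq(2) p sides by (auto simp: S_def)
      ultimately show ?thesis using pq(1) vl by (auto simp: A_def)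
    qed
    show "E \<inter> S \<times> S \<subseteq> A \<union> A\<inverse>"
    proof
      fix e assume "e \<in> E \<inter> S \<times> S"
      then obtain p q where e: "e = (p, q)" "(p, q) \<in> E" "p \<in> S" "q \<in> S" by blast
      show "e \<in> A \<union> A\<inverse>"
      proof (cases "p \<in> X \<longleftrightarrow> u \<in> X")
        case True
        then show ?thesis using half[OF e(2-4)] e(1) by simp
      next
        case False
        then have "q \<in> X \<longleftrightarrow> u \<in> X" using edge_sides[OF e(2)] by blast
        then have "(q, p) \<in> A \<union> A\<inverse>" using half[OF edge_sym[OF e(2)] e(4,3)] by simp
        then show ?thesis using e(1) by blast
      qed
    qed
  qed
  define H where "H = with_proj \<lparr> pverts = S, parcs = E \<inter> S \<times> S \<rparr>"
  have wfG: "wf_digraph (with_proj G)" using G(1) by (simp add: wf_digraph_wp_iff)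
  have wfH: "wf_digraph H" by unfold_locales (auto simp: H_def)
  have "induced_subgraph H G"
    unfolding induced_subgraph_def subgraph_def compatible_def
    using wfG wfH SV G by (auto simp: H_def)
  moreover have "digraph_iso H S13"
  proof -
    define h :: "'a \<Rightarrow> nat" where "h x = (if x = v then 0 else if x = c then 1 else if x = u then 2
      else if x = l1 then 3 else if x = l2 then 4 else 5)" for x
    have h: "h v = 0" "h c = 1" "h u = 2" "h l1 = 3" "h l2 = 4" "h l3 = 5"
      using dist by (auto simp: h_def)
    have inj: "inj_on h S" using h by (auto simp: S_def inj_on_def)
    define hom where "hom = \<lparr> iso_verts = h, iso_arcs = map_prod h h, iso_head = snd, iso_tail = fst \<rparr>"
    have "inj_on (map_prod h h) (E \<inter> S \<times> S)"
      using map_prod_inj_on[OF inj inj] by (rule inj_on_subset) auto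
    then have "pre_digraph.digraph_isomorphism H hom"
      unfolding pre_digraph.digraph_isomorphism_def
      using wfH inj by (auto simp: H_def hom_def)
    moreover have "h ` S = {0, 1} \<union> {2, 3, 4, 5}" unfolding S_def image_insert h by auto
    moreover have "map_prod h h ` (E \<inter> S \<times> S) =
        ({0} \<times> {1} \<union> {2} \<times> {3, 4, 5} \<union> {(1, 2)}) \<union> ({0} \<times> {1} \<union> {2} \<times> {3, 4, 5} \<union> {(1, 2)})\<inverse>"
    proof -
      have "map_prod h h ` A = {(0, 1), (1, 2), (2, 3), (2, 4), (2, 5)}"
        unfolding A_def image_insert map_prod_simp h by simp
      also have "\<dots> = {0} \<times> {1} \<union> {2} \<times> {3, 4, 5} \<union> {(1, 2)}" by blast
      finally have "map_prod h h ` A = {0} \<times> {1} \<union> {2} \<times> {3, 4, 5} \<union> {(1, 2)}" .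
      moreover have "map_prod h h ` A\<inverse> = (map_prod h h ` A)\<inverse>" by force
      ultimately show ?thesis unfolding arcs image_Un by simp
    qed
    ultimately show ?thesis
      unfolding digraph_iso_def
      by (intro exI[of _ hom]) (simp add: app_iso_def with_proj_def S13_def H_def hom_def Let_def)
  qed
  ultimately show ?thesis unfolding induced_free_def by blast
qed

theorem theorem3:
  fixes G :: "'a pair_pre_digraph" and X Y :: "'a set"
  assumes "pair_graph G"
    and "connected G"
    and "balanced_bipartition G X Y"
    and "induced_free S13 G"
    and "min_degree G \<ge> 4"
  shows "\<exists>p. hamilton_cycle G p"
proof -
  interpret pair_graph G by fact
  have V: "X \<union> Y = pverts G" "X \<inter> Y = {}" "parcs G \<subseteq> X \<times> Y \<union> Y \<times> X" "card X = card Y"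
    using assms(3) by (auto simp: balanced_bipartition_def bipartition_def)
  have finV: "finite X" "finite Y" using V(1) pair_finite_verts by (metis finite_Un)+
  have symE: "sym (parcs G)" using pair_sym_arcs by (simp add: symmetric_def)
  interpret B: bipartite_graph "parcs G" X Y
    using V finV symE by unfold_locales auto
  have sc: "strongly_connected (mk_symmetric G)" using assms(2) by (simp add: connected_def)
  \<comment> \<open>\<open>connected\<close> refers to the symmetric closure, which adds no arcs to
    a symmetric graph.\<close>
  have "parcs (mk_symmetric G) = parcs G"
    using adj_mk_symmetric_eq[OF pair_sym_arcs] by simp
  then have conn: "(u, v) \<in> (parcs G)\<^sup>*" if "u \<in> X \<union> Y" "v \<in> X \<union> Y" for u v
    using sc that V(1) reachable_rtranclI[of "with_proj (mk_symmetric G)" u v]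
    by (auto simp: strongly_connected_def)
  have deg: "4 \<le> card (parcs G `` {v})" if "v \<in> X \<union> Y" for v
  proof -
    have "min_degree G \<le> out_degree G v"
      unfolding min_degree_def using that V(1) pair_finite_verts by (intro Min_le) auto
    moreover have "out_arcs G v = Pair v ` (parcs G `` {v})" by (auto simp: out_arcs_def)
    then have "out_degree G v = card (parcs G `` {v})"
      by (simp add: out_degree_def card_image inj_on_def)
    ultimately show ?thesis using assms(5) by simp
  qed
  have "card (parcs G `` {u} - parcs G `` {v}) \<le> 2" if "parcs G `` {u} \<inter> parcs G `` {v} \<noteq> {}" for u v
    using B.induced_S13[OF pair_wf_digraph refl _ that] V(1) assms(4) by fastforce
  then interpret B: balanced_S13_free_graph "parcs G" X Y
    using V(4) conn deg by unfold_locales auto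
  \<comment> \<open>A strongly connected digraph has a vertex by definition, and balance rules out
    that \<open>X\<close> alone is empty.\<close>
  have "X \<noteq> {}"
  proof
    assume "X = {}"
    then have "X \<union> Y = {}" using V(4) finV by simp
    then show False using sc V(1) by (simp add: strongly_connected_def)
  qed
  then obtain v n where "3 \<le> n" "v n = v 0" "inj_on v {..<n}" "v ` {..<n} = X \<union> Y"
      "\<forall>k<n. (v k, v (Suc k)) \<in> parcs G"
    using B.ex_connected_two_factor B.connected_two_factor_sequence by metis
  then show ?thesis using hamilton_cycle_map_upt[of n v G] V(1) by auto
qed

end
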